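(* Let $\mathsf{L}^{\mathsf{A}}$ be any of the logics described in the context and $\mathsf{CS}$ any constant specification. For every formula $F$ of the purely propositional language (built from atomic propositions and $\bot$ with $\to$, no terms): $\mathsf{L}^{\mathsf{A}}_{\mathsf{CS}}\vdash F$ if and only if $\mathsf{CL}\vdash F$, where $\mathsf{CL}$ is classical propositional logic.
   Context: Terms: $t::=c_i\mid x_i\mid (t\cdot t)\mid(t+t)\mid\ !t$ ($c_i$ constants, $x_i$ variables). Formulas: $F::=p_i\mid\bot\mid F\to F\mid t:F$. Axiom schemes: (cl) all classical propositional axioms (instantiated in this language); (j) $s:(A\to B)\to(t:A\to s\cdot t:B)$; (j+) $s:A\lor t:A\to(s+t):A$; (j4) $t:A\to\ !t:(t:A)$; (jd) $t:\bot\to\bot$; (jt) $t:A\to A$. A logic $\mathsf{L}^{\mathsf{A}}$ consists of (cl),(j),(j+) and some subset of $\{$(j4),(jd),(jt)$\}$. A constant specification $\mathsf{CS}$ is a set of pairs $(c,A)$, $c$ a constant, $A$ an axiom of $\mathsf{L}^{\mathsf{A}}$. $\mathsf{L}^{\mathsf{A}}_{\mathsf{CS}}$: Hilbert system with these axioms, modus ponens and axiom necessitation (for $(c,A)\in\mathsf{CS}$, $n\ge0$ infer $!^nc:\,!^{n-1}c:\cdots:\,!c:c:A$). *)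

theory Defs
  imports Main
begin

section \<open>Classical propositional logic\<close>

datatype pfm =
    PAtom nat
  | PBot
  | PImp pfm pfm

primrec psubst :: "(nat \<Rightarrow> pfm) \<Rightarrow> pfm \<Rightarrow> pfm" where
  "psubst \<sigma> (PAtom i) = \<sigma> i"
| "psubst \<sigma> PBot = PBot"
| "psubst \<sigma> (PImp P Q) = PImp (psubst \<sigma> P) (psubst \<sigma> Q)"

primrec peval :: "(nat \<Rightarrow> bool) \<Rightarrow> pfm \<Rightarrow> bool" where
  "peval v (PAtom i) = v i"
| "peval v PBot = False"
| "peval v (PImp P Q) = (peval v P \<longrightarrow> peval v Q)"

text \<open>A set \<open>\<Gamma>\<close> of propositional formulas is read as a set of axiom schemes, whose atoms are
  the schematic letters.\<close>

inductive CL_derivable :: "pfm set \<Rightarrow> pfm \<Rightarrow> bool" for \<Gamma> :: "pfm set" where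
  ax: "P \<in> \<Gamma> \<Longrightarrow> CL_derivable \<Gamma> (psubst \<sigma> P)"
| mp: "CL_derivable \<Gamma> (PImp P Q) \<Longrightarrow> CL_derivable \<Gamma> P \<Longrightarrow> CL_derivable \<Gamma> Q"

text \<open>No particular choice of ``the classical propositional axioms'' is singled out: any set of
  schemes that, with modus ponens, axiomatizes classical propositional logic is admitted. The choice
  matters for which pairs may occur in a constant specification.\<close>

definition classical_axiomatization :: "pfm set \<Rightarrow> bool" where
  "classical_axiomatization \<Gamma> \<longleftrightarrow> (\<forall>P. CL_derivable \<Gamma> P \<longleftrightarrow> (\<forall>v. peval v P))"


section \<open>Justification logics\<close>

datatype jterm =
    Const nat
  | Var nat
  | App jterm jterm
  | Plus jterm jterm
  | Bang jterm

datatype fm =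
    Atom nat
  | Bot
  | Imp fm fm  (infixr "\<^bold>\<longrightarrow>" 55)
  | Just jterm fm  (infixr "\<Colon>" 60)

text \<open>Disjunction is not primitive; it abbreviates \<open>\<not> A \<rightarrow> B\<close> with \<open>\<not> A = (A \<rightarrow> \<bottom>)\<close>.\<close>

abbreviation Disj :: "fm \<Rightarrow> fm \<Rightarrow> fm"  (infixr "\<^bold>\<or>" 57) where
  "A \<^bold>\<or> B \<equiv> (A \<^bold>\<longrightarrow> Bot) \<^bold>\<longrightarrow> B"

primrec inst :: "(nat \<Rightarrow> fm) \<Rightarrow> pfm \<Rightarrow> fm" where
  "inst \<sigma> (PAtom i) = \<sigma> i"
| "inst \<sigma> PBot = Bot"
| "inst \<sigma> (PImp P Q) = (inst \<sigma> P \<^bold>\<longrightarrow> inst \<sigma> Q)"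

definition embed :: "pfm \<Rightarrow> fm" where
  "embed = inst Atom"

datatype optional_scheme = J4 | JD | JT

text \<open>A logic is given by the schemes \<open>\<Gamma>\<close> used for (cl) and the set \<open>X\<close> of its optional schemes.\<close>

inductive axiom :: "pfm set \<Rightarrow> optional_scheme set \<Rightarrow> fm \<Rightarrow> bool"
  for \<Gamma> :: "pfm set" and X :: "optional_scheme set" where
  cl: "P \<in> \<Gamma> \<Longrightarrow> axiom \<Gamma> X (inst \<sigma> P)"
| j: "axiom \<Gamma> X (s \<Colon> (A \<^bold>\<longrightarrow> B) \<^bold>\<longrightarrow> (t \<Colon> A \<^bold>\<longrightarrow> App s t \<Colon> B))"
| jplus: "axiom \<Gamma> X ((s \<Colon> A \<^bold>\<or> t \<Colon> A) \<^bold>\<longrightarrow> Plus s t \<Colon> A)"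
| j4: "J4 \<in> X \<Longrightarrow> axiom \<Gamma> X (t \<Colon> A \<^bold>\<longrightarrow> Bang t \<Colon> (t \<Colon> A))"
| jd: "JD \<in> X \<Longrightarrow> axiom \<Gamma> X (t \<Colon> Bot \<^bold>\<longrightarrow> Bot)"
| jt: "JT \<in> X \<Longrightarrow> axiom \<Gamma> X (t \<Colon> A \<^bold>\<longrightarrow> A)"

definition constant_specification ::
    "pfm set \<Rightarrow> optional_scheme set \<Rightarrow> (nat \<times> fm) set \<Rightarrow> bool" where
  "constant_specification \<Gamma> X CS \<longleftrightarrow> (\<forall>(c, A) \<in> CS. axiom \<Gamma> X A)"

primrec necessitation :: "nat \<Rightarrow> nat \<Rightarrow> fm \<Rightarrow> fm" where
  "necessitation 0 c A = Const c \<Colon> A"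
| "necessitation (Suc n) c A = (Bang ^^ Suc n) (Const c) \<Colon> necessitation n c A"

inductive derivable ::
    "pfm set \<Rightarrow> optional_scheme set \<Rightarrow> (nat \<times> fm) set \<Rightarrow> fm \<Rightarrow> bool"
  for \<Gamma> :: "pfm set" and X :: "optional_scheme set" and CS :: "(nat \<times> fm) set" where
  ax: "axiom \<Gamma> X A \<Longrightarrow> derivable \<Gamma> X CS A"
| mp: "derivable \<Gamma> X CS (A \<^bold>\<longrightarrow> B) \<Longrightarrow> derivable \<Gamma> X CS A \<Longrightarrow> derivable \<Gamma> X CS B"
| an: "(c, A) \<in> CS \<Longrightarrow> derivable \<Gamma> X CS (necessitation n c A)"

end

(* Erasing all justification terms turns (j), (j+), (j4), (jd), (jt) and every necessitated axiom
   into a propositional tautology and fixes the purely propositional formulas.  Evaluating formulas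
   up to this erasure, conservativity follows from completeness of CL. *)
theory Submission
  imports Defs
begin

text \<open>Erasure is fused with evaluation: the last clause skips the term, so no separate map
  from \<open>fm\<close> back to \<open>pfm\<close> has to be defined.\<close>

primrec feval :: "(nat \<Rightarrow> bool) \<Rightarrow> fm \<Rightarrow> bool" where
  "feval v (Atom i) = v i"
| "feval v Bot = False"
| "feval v (A \<^bold>\<longrightarrow> B) = (feval v A \<longrightarrow> feval v B)"
| "feval v (t \<Colon> A) = feval v A"

lemma feval_inst: "feval v (inst \<sigma> P) = peval (\<lambda>i. feval v (\<sigma> i)) P"
  by (induction P) simp_all

lemma feval_embed: "feval v (embed P) = peval v P"
  by (simp add: embed_def feval_inst)

lemma feval_necessitation: "feval v (necessitation n c A) = feval v A"
  by (induction n) simp_all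

lemma psubst_PAtom: "psubst PAtom P = P"
  by (induction P) simp_all

lemma inst_psubst: "inst \<tau> (psubst \<sigma> P) = inst (\<lambda>i. inst \<tau> (\<sigma> i)) P"
  by (induction P) simp_all

text \<open>A scheme is its own instance under the identity substitution \<open>PAtom\<close>, hence
  derivable, and soundness of the axiomatization applies.\<close>

lemma classical_axiomatization_valid:
  assumes "classical_axiomatization \<Gamma>" and "P \<in> \<Gamma>"
  shows "peval v P"
proof -
  have "CL_derivable \<Gamma> P"
    using CL_derivable.ax [OF assms(2), of PAtom] by (simp add: psubst_PAtom)
  then show ?thesis
    using assms(1) by (simp add: classical_axiomatization_def)
qed

text \<open>With terms ignored, (j) reads (A \<rightarrow> B) \<rightarrow> (A \<rightarrow> B),
  (j+) reads A \<or> A \<rightarrow> A, and the optional schemes read A \<rightarrow> A.\<close>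

lemma axiom_feval:
  assumes "classical_axiomatization \<Gamma>" and "axiom \<Gamma> X A"
  shows "feval v A"
  using assms(2)
  by cases (auto simp: feval_inst classical_axiomatization_valid [OF assms(1)])

lemma derivable_feval:
  assumes "classical_axiomatization \<Gamma>" and "constant_specification \<Gamma> X CS"
    and "derivable \<Gamma> X CS A"
  shows "feval v A"
  using assms(3)
proof induction
  case (ax A)
  then show ?case by (rule axiom_feval [OF assms(1)])
next
  case (mp A B)
  then show ?case by simp
next
  case (an c A n)
  then have "axiom \<Gamma> X A"
    using assms(2) by (auto simp: constant_specification_def)
  then show ?case
    by (simp add: feval_necessitation axiom_feval [OF assms(1)])
qed

lemma derivable_embed:
  assumes "CL_derivable \<Gamma> P"
  shows "derivable \<Gamma> X CS (embed P)"
  using assms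
proof induction
  case (ax P \<sigma>)
  then show ?case
    \<comment> \<open>Embedding an instance of a scheme gives the instance that sends each letter
      \<open>i\<close> to the embedding of \<open>\<sigma> i\<close>, so it is again a (cl)
      axiom.\<close>
    by (simp add: embed_def inst_psubst axiom.cl derivable.ax)
next
  case (mp P Q)
  then show ?case
    by (auto simp: embed_def intro: derivable.mp)
qed

theorem mainTheorem8:
  fixes \<Gamma> :: "pfm set"
    and X :: "optional_scheme set"
    and CS :: "(nat \<times> fm) set"
    and F :: pfm
  assumes "classical_axiomatization \<Gamma>"
    and "constant_specification \<Gamma> X CS"
  shows "derivable \<Gamma> X CS (embed F) \<longleftrightarrow> CL_derivable \<Gamma> F"
proof
  assume "derivable \<Gamma> X CS (embed F)"
  then have "\<forall>v. peval v F"
    using derivable_feval [OF assms] by (simp flip: feval_embed)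
  \<comment> \<open>Here the completeness half of \<open>classical_axiomatization\<close>
    enters.\<close>
  then show "CL_derivable \<Gamma> F"
    using assms(1) by (simp add: classical_axiomatization_def)
next
  assume "CL_derivable \<Gamma> F"
  then show "derivable \<Gamma> X CS (embed F)"
    by (rule derivable_embed)
qed

end
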